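(* Let $B\subset S$ be any set of patterns with $1\notin B$, and let $m\geq 1$ be a natural number. Suppose that for every node $\pi$ of $D[B]$ with $|\pi|=m$, the generating function $F_\pi(x)$ can be expressed as a rational linear combination of the functions $F_{\pi'}(x)$ with $\pi'\in D[B]$ and $|\pi'|\leq m$, in such a way that the corresponding coefficients $c_j(x)$ satisfy $c_j(0)=0$ for all $j$. Then $G_B(x)$ is a rational generating function (i.e. it is the power series expansion at $0$ of a rational function of $x$).
   Context: Permutations and patterns. $S_n$ is the set of permutations of $[n]=\{1,\dots,n\}$ written as words, $S=\bigcup_{n\ge1}S_n$, and $|\pi|=n$ for $\pi\in S_n$. The permutation of length one is denoted $1$. A permutation $\sigma\in S_n$ contains $\tau\in S_k$ if there are indices $i_1<\dots<i_k$ such that $\sigma(i_a)<\sigma(i_b)$ iff $\tau(a)<\tau(b)$ for all $a,b$; otherwise it avoids $\tau$. $S_n(B)$ is the set of permutations in $S_n$ avoiding every $\tau\in B$, $S(B)=\bigcup_{n\ge 1}S_n(B)$, and $G_B(x)=\sum_{n\ge1}|S_n(B)|x^n$. Pattern-avoidance tree. $T(B)$ is the rooted tree with root $1$ whose $n$-th level is $S_n(B)$ (the root is level $1$); the parent of $\pi\in S_n(B)$, $n\ge2$, is the permutation in $S_{n-1}(B)$ obtained by deleting the letter $n$ from $\pi$. For $\pi\in S(B)$, $T(B;\pi)$ is the subtree of $T(B)$ consisting of $\pi$ and all its descendants, with root $\pi$ at level $1$ of $T(B;\pi)$. Call $\pi,\pi'\in S(B)$ equivalent if $T(B;\pi)\cong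 T(B;\pi')$ as rooted trees. Each equivalence class is labeled by one fixed representative of minimal length in the class. The directed graph $D[B]$. Its nodes are these representatives (one per equivalence class). For nodes $v,w$, the number of edges from $v$ to $w$ is the number of children of $v$ in $T(B)$ that are equivalent to $w$ (so loops and multiple edges are allowed). The length $|v|$ of a node $v$ is its length as a permutation. Generating functions $F_\pi$. For $\pi\in S(B)$ let $P_n(B;\pi)$ be the number of nodes at the $n$-th level of $T(B;\pi)$, and put $F_\pi(x)=x^{|\pi|-1}\sum_{n\ge1}P_n(B;\pi)x^n$. In particular $G_B(x)=F_1(x)$. Rational linear combination. $a(x)$ is a rational linear combination of $b_1(x),\dots,b_s(x)$ if there are rational functions $c_0(x),\dots,c_s(x)$ such that $a(x)=c_0(x)+\sum_{j=1}^s c_j(x)b_j(x)$; the $c_j(x)$ are the corresponding coefficients. *)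

theory Defs
  imports
    "HOL-Combinatorics.Multiset_Permutations"
    "HOL-Computational_Algebra.Computational_Algebra"
    "Graph_Theory.Digraph"
begin

section \<open>Permutations and patterns\<close>

text \<open>Permutations of \<open>{1..n}\<close> are represented by their words.\<close>

type_synonym perm_word = "nat list"

definition perms_of_length :: "nat \<Rightarrow> perm_word set" where
  "perms_of_length n = permutations_of_set {1..n}"

definition all_perms :: "perm_word set" where
  "all_perms = (\<Union>n\<in>{1..}. perms_of_length n)"

definition contains :: "perm_word \<Rightarrow> perm_word \<Rightarrow> bool" where
  "contains \<sigma> \<tau> \<longleftrightarrow>
     (\<exists>i. strict_mono_on {..<length \<tau>} i \<and>
          (\<forall>a<length \<tau>. i a < length \<sigma>) \<and>
          (\<forall>a<length \<tau>. \<forall>b<length \<tau>. \<sigma> ! i a < \<sigma> ! i b \<longleftrightarrow> \<tau> ! a < \<tau> ! b))"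

definition avoiders_of_length :: "perm_word set \<Rightarrow> nat \<Rightarrow> perm_word set" where
  "avoiders_of_length B n = {\<sigma> \<in> perms_of_length n. \<forall>\<tau>\<in>B. \<not> contains \<sigma> \<tau>}"

definition avoiders :: "perm_word set \<Rightarrow> perm_word set" where
  "avoiders B = (\<Union>n\<in>{1..}. avoiders_of_length B n)"

definition avoiders_gf :: "perm_word set \<Rightarrow> 'a::field_char_0 fps" where
  "avoiders_gf B = Abs_fps (\<lambda>n. if n = 0 then 0 else of_nat (card (avoiders_of_length B n)))"


section \<open>Rooted trees\<close>

text \<open>Edges are pairs (parent, child).\<close>

record 'v rooted_tree =
  nodes :: "'v set"
  root :: 'v
  tree_edges :: "('v \<times> 'v) set"

definition subtree_at :: "'v rooted_tree \<Rightarrow> 'v \<Rightarrow> 'v rooted_tree" where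
  "subtree_at T v =
     (let V = (tree_edges T)\<^sup>* `` {v}
      in \<lparr>nodes = V, root = v, tree_edges = tree_edges T \<inter> V \<times> V\<rparr>)"

text \<open>Levels are numbered from \<open>1\<close>, the level of the root.
  The value at \<open>0\<close> has no meaning and is never used.\<close>

definition level :: "'v rooted_tree \<Rightarrow> nat \<Rightarrow> 'v set" where
  "level T n = {v \<in> nodes T. (root T, v) \<in> tree_edges T ^^ (n - 1)}"

definition rooted_tree_iso :: "'v rooted_tree \<Rightarrow> 'w rooted_tree \<Rightarrow> bool" where
  "rooted_tree_iso T U \<longleftrightarrow>
     (\<exists>f. bij_betw f (nodes T) (nodes U) \<and> f (root T) = root U \<and>
          (\<forall>x\<in>nodes T. \<forall>y\<in>nodes T. (x, y) \<in> tree_edges T \<longleftrightarrow> (f x, f y) \<in> tree_edges U))"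


section \<open>The pattern-avoidance tree\<close>

definition delete_max :: "perm_word \<Rightarrow> perm_word" where
  "delete_max \<sigma> = removeAll (length \<sigma>) \<sigma>"

definition avoidance_tree :: "perm_word set \<Rightarrow> perm_word rooted_tree" where
  "avoidance_tree B =
     \<lparr>nodes = avoiders B, root = [1],
      tree_edges = {(delete_max \<sigma>, \<sigma>) |\<sigma>. \<sigma> \<in> avoiders B \<and> length \<sigma> \<ge> 2}\<rparr>"

definition avoidance_subtree :: "perm_word set \<Rightarrow> perm_word \<Rightarrow> perm_word rooted_tree" where
  "avoidance_subtree B \<pi> = subtree_at (avoidance_tree B) \<pi>"

definition equivalent :: "perm_word set \<Rightarrow> perm_word \<Rightarrow> perm_word \<Rightarrow> bool" where
  "equivalent B \<pi> \<pi>' \<longleftrightarrow> rooted_tree_iso (avoidance_subtree B \<pi>) (avoidance_subtree B \<pi>')"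

definition subtree_gf :: "perm_word set \<Rightarrow> perm_word \<Rightarrow> 'a::field_char_0 fps" where
  "subtree_gf B \<pi> =
     fps_X ^ (length \<pi> - 1) *
     Abs_fps (\<lambda>n. if n = 0 then 0 else of_nat (card (level (avoidance_subtree B \<pi>) n)))"


section \<open>The digraph of equivalence classes\<close>

text \<open>\<open>R\<close> contains exactly one element of each equivalence class, of minimal length in its class.
  The choice is not unique, so \<open>R\<close> is a parameter.\<close>

definition minimal_representatives :: "perm_word set \<Rightarrow> perm_word set \<Rightarrow> bool" where
  "minimal_representatives B R \<longleftrightarrow>
     R \<subseteq> avoiders B \<and>
     (\<forall>\<pi>\<in>avoiders B. \<exists>!\<rho>. \<rho> \<in> R \<and> equivalent B \<pi> \<rho>) \<and>
     (\<forall>\<rho>\<in>R. \<forall>\<pi>\<in>avoiders B. equivalent B \<pi> \<rho> \<longrightarrow> length \<rho> \<le> length \<pi>)"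

text \<open>There is one arc \<open>(v, \<sigma>)\<close> for each child \<open>\<sigma>\<close> of a node \<open>v\<close>. It leads
  to the representative of \<open>\<sigma>\<close>, so parallel arcs and loops may occur.\<close>

definition class_digraph ::
  "perm_word set \<Rightarrow> perm_word set \<Rightarrow> (perm_word, perm_word \<times> perm_word) pre_digraph" where
  "class_digraph B R =
     \<lparr>verts = R,
      arcs = {(v, \<sigma>) \<in> tree_edges (avoidance_tree B). v \<in> R},
      tail = fst,
      head = (\<lambda>(v, \<sigma>). THE w. w \<in> R \<and> equivalent B \<sigma> w)\<rparr>"


section \<open>Rational functions and rational linear combinations\<close>

text \<open>Rational functions are the elements of \<open>'a poly fract\<close>. Since a rational function may have
  a pole at \<open>0\<close>, its expansion at \<open>0\<close> is a Laurent series.\<close>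

definition expansion_at_0 :: "'a::field poly fract \<Rightarrow> 'a fls" where
  "expansion_at_0 c =
     (THE f. \<exists>p q. q \<noteq> 0 \<and> c = Fract p q \<and>
                    f = fps_to_fls (fps_of_poly p) / fps_to_fls (fps_of_poly q))"

lemma expansion_at_0_Fract:
  fixes p q :: "'a::field poly"
  assumes "q \<noteq> 0"
  shows "expansion_at_0 (Fract p q) = fps_to_fls (fps_of_poly p) / fps_to_fls (fps_of_poly q)"
  unfolding expansion_at_0_def
proof (rule the_equality)
  fix f :: "'a fls"
  assume "\<exists>p' q'. q' \<noteq> 0 \<and> Fract p q = Fract p' q' \<and>
                  f = fps_to_fls (fps_of_poly p') / fps_to_fls (fps_of_poly q')"
  then obtain p' q' where q': "q' \<noteq> 0" and eq: "p * q' = p' * q"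
    and f: "f = fps_to_fls (fps_of_poly p') / fps_to_fls (fps_of_poly q')"
    using assms by (auto simp: eq_fract)
  have "fps_to_fls (fps_of_poly p) * fps_to_fls (fps_of_poly q') =
        fps_to_fls (fps_of_poly p') * fps_to_fls (fps_of_poly q)"
    by (metis eq fls_times_fps_to_fls fps_of_poly_mult)
  with assms q' show "f = fps_to_fls (fps_of_poly p) / fps_to_fls (fps_of_poly q)"
    by (simp add: f frac_eq_eq)
qed (use assms in blast)

definition has_value_at :: "'a::field poly fract \<Rightarrow> 'a \<Rightarrow> 'a \<Rightarrow> bool" where
  "has_value_at c a y \<longleftrightarrow>
     (\<exists>p q. poly q a \<noteq> 0 \<and> c = Fract p q \<and> y = poly p a / poly q a)"

definition rational_linear_combination ::
  "'a::field fps \<Rightarrow> ('i \<Rightarrow> 'a fps) \<Rightarrow> 'i set \<Rightarrow> 'a poly fract \<Rightarrow> ('i \<Rightarrow> 'a poly fract) \<Rightarrow> bool" where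
  "rational_linear_combination a b J c0 c \<longleftrightarrow>
     fps_to_fls a =
       expansion_at_0 c0 + (\<Sum>j\<in>J. expansion_at_0 (c j) * fps_to_fls (b j))"

definition rational_gf :: "'a::field fps \<Rightarrow> bool" where
  "rational_gf f \<longleftrightarrow> (\<exists>r. fps_to_fls f = expansion_at_0 r)"

end

theory Submission
  imports Defs
begin

text \<open>
  A node \<open>v\<close> with \<open>length v < m\<close> satisfies
  \<open>F\<^sub>v = x\<^bsup>|v|\<^esup> + (\<Sum>\<sigma>. x\<^bsup>|v| + 1 - |w|\<^esup> F\<^sub>w)\<close>, summed over the children \<open>\<sigma>\<close> of \<open>v\<close> with
  representative \<open>w\<close>, where \<open>|w| \<le> |\<sigma>| = |v| + 1 \<le> m\<close>. Together with the hypothesis for length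
  \<open>m\<close> this is a finite linear system \<open>F = c + M F\<close> over the rational power series, in which
  \<open>M\<^sub>v\<^sub>w\<close> has a nonzero constant term only if \<open>|v| < |w|\<close>. So \<open>M\<close> is nilpotent at \<open>x = 0\<close>,
  and the system can be solved by eliminating the unknowns one after the other.
\<close>

section \<open>Rational power series\<close>

text \<open>Clearing the denominator. Since \<open>fps_to_fls\<close> is injective, this form
  involves power series only, and the closure properties become computations with numerators and
  denominators.\<close>

lemma rational_gf_iff:
  "rational_gf (f :: 'a::field fps) \<longleftrightarrow> (\<exists>p q. q \<noteq> 0 \<and> f * fps_of_poly q = fps_of_poly p)"
proof
  assume "rational_gf f"
  then obtain r where r: "fps_to_fls f = expansion_at_0 r"
    by (auto simp: rational_gf_def)
  obtain p q where pq: "r = Fract p q" "q \<noteq> 0" by (cases r) auto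
  have "fps_to_fls f * fps_to_fls (fps_of_poly q) = fps_to_fls (fps_of_poly p)"
    using r pq by (simp add: expansion_at_0_Fract)
  then have "f * fps_of_poly q = fps_of_poly p"
    by (metis fls_times_fps_to_fls fps_to_fls_eq_iff)
  then show "\<exists>p q. q \<noteq> 0 \<and> f * fps_of_poly q = fps_of_poly p" using pq by blast
next
  assume "\<exists>p q. q \<noteq> 0 \<and> f * fps_of_poly q = fps_of_poly p"
  then obtain p q where pq: "q \<noteq> 0" "f * fps_of_poly q = fps_of_poly p" by blast
  then have "fps_to_fls f * fps_to_fls (fps_of_poly q) = fps_to_fls (fps_of_poly p)"
    by (metis fls_times_fps_to_fls)
  then have "fps_to_fls f = expansion_at_0 (Fract p q)"
    using pq by (simp add: expansion_at_0_Fract eq_divide_eq)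
  then show "rational_gf f" by (auto simp: rational_gf_def)
qed

lemma rational_gf_of_poly: "rational_gf (fps_of_poly p)"
  unfolding rational_gf_iff by (rule exI[of _ p], rule exI[of _ 1]) simp

lemma rational_gf_0: "rational_gf 0"
  using rational_gf_of_poly[of 0] by simp

lemma rational_gf_1: "rational_gf 1"
  using rational_gf_of_poly[of 1] by simp

lemma rational_gf_X_power: "rational_gf (fps_X ^ n)"
  using rational_gf_of_poly[of "monom 1 n"] by (simp add: fps_of_poly_monom)

lemma rational_gf_add:
  assumes "rational_gf f" "rational_gf g"
  shows "rational_gf (f + g)"
proof -
  obtain p q where 1: "q \<noteq> 0" "f * fps_of_poly q = fps_of_poly p"
    using assms(1) by (auto simp: rational_gf_iff)
  obtain p' q' where 2: "q' \<noteq> 0" "g * fps_of_poly q' = fps_of_poly p'"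
    using assms(2) by (auto simp: rational_gf_iff)
  have "(f + g) * fps_of_poly (q * q') =
      (f * fps_of_poly q) * fps_of_poly q' + (g * fps_of_poly q') * fps_of_poly q"
    by (simp add: fps_of_poly_mult algebra_simps)
  also have "\<dots> = fps_of_poly (p * q' + p' * q)"
    by (simp add: 1 2 fps_of_poly_mult fps_of_poly_add)
  finally show ?thesis using 1 2 unfolding rational_gf_iff by (metis mult_eq_0_iff)
qed

lemma rational_gf_mult:
  assumes "rational_gf f" "rational_gf g"
  shows "rational_gf (f * g)"
proof -
  obtain p q where 1: "q \<noteq> 0" "f * fps_of_poly q = fps_of_poly p"
    using assms(1) by (auto simp: rational_gf_iff)
  obtain p' q' where 2: "q' \<noteq> 0" "g * fps_of_poly q' = fps_of_poly p'"
    using assms(2) by (auto simp: rational_gf_iff)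
  have "f * g * fps_of_poly (q * q') = (f * fps_of_poly q) * (g * fps_of_poly q')"
    by (simp add: fps_of_poly_mult algebra_simps)
  also have "\<dots> = fps_of_poly (p * p')"
    by (simp add: 1 2 fps_of_poly_mult)
  finally show ?thesis using 1 2 unfolding rational_gf_iff by (metis mult_eq_0_iff)
qed

lemma rational_gf_minus: "rational_gf f \<Longrightarrow> rational_gf (- f)"
  unfolding rational_gf_iff by (metis fps_of_poly_uminus mult_minus_left)

text \<open>Numerator and denominator change places. A nonzero constant term makes
  \<open>inverse f\<close> a true inverse, and then \<open>p\<close> cannot vanish because
  \<open>q\<close> does not.\<close>

lemma rational_gf_inverse:
  assumes "rational_gf f" "f $ 0 \<noteq> 0"
  shows "rational_gf (inverse f)"
proof -
  obtain p q where 1: "q \<noteq> 0" "f * fps_of_poly q = fps_of_poly p"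
    using assms(1) by (auto simp: rational_gf_iff)
  have inv: "inverse f * f = 1" using assms(2) by (rule inverse_mult_eq_1)
  have "inverse f * fps_of_poly p = (inverse f * f) * fps_of_poly q"
    by (simp add: 1(2)[symmetric] mult.assoc)
  then have "inverse f * fps_of_poly p = fps_of_poly q" by (simp add: inv)
  moreover from this have "p \<noteq> 0" using 1(1) by auto
  ultimately show ?thesis unfolding rational_gf_iff by blast
qed

lemma rational_gf_sum: "(\<And>i. i \<in> A \<Longrightarrow> rational_gf (f i)) \<Longrightarrow> rational_gf (sum f A)"
  by (induction A rule: infinite_finite_induct) (auto intro: rational_gf_0 rational_gf_add)

section \<open>Rational functions without a pole at 0\<close>

lemma expansion_at_0_has_value_at:
  assumes "has_value_at c 0 y"
  obtains g where "expansion_at_0 c = fps_to_fls g" "g $ 0 = y" "rational_gf g"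
proof -
  obtain p q where pq: "poly q 0 \<noteq> 0" "c = Fract p q" "y = poly p 0 / poly q 0"
    using assms by (auto simp: has_value_at_def)
  \<comment> \<open>The denominator is a unit among power series, so the Laurent expansion is a
    power series, with the value at 0 as its constant term.\<close>
  have q0: "fps_of_poly q $ 0 \<noteq> 0" using pq by (simp add: poly_0_coeff_0)
  have "q \<noteq> 0" using pq by auto
  let ?g = "fps_of_poly p * inverse (fps_of_poly q)"
  have "?g * fps_of_poly q = fps_of_poly p"
    using inverse_mult_eq_1[OF q0] by (simp add: mult.assoc)
  then have "fps_to_fls ?g * fps_to_fls (fps_of_poly q) = fps_to_fls (fps_of_poly p)"
    by (metis fls_times_fps_to_fls)
  then have "expansion_at_0 c = fps_to_fls ?g"
    using pq \<open>q \<noteq> 0\<close> by (simp add: expansion_at_0_Fract divide_eq_eq)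
  moreover have "?g $ 0 = y"
    using pq by (simp add: poly_0_coeff_0 divide_inverse)
  moreover have "rational_gf ?g"
    by (intro rational_gf_mult rational_gf_inverse rational_gf_of_poly q0)
  ultimately show ?thesis using that by blast
qed

text \<open>All coefficients expand to power series, so the relation between Laurent series can be
  read back through the injective embedding \<open>fps_to_fls\<close>.\<close>

lemma rational_linear_combination_fps:
  assumes "rational_linear_combination a b J c0 c" "has_value_at c0 0 0"
    and "\<And>j. j \<in> J \<Longrightarrow> has_value_at (c j) 0 0"
  obtains d0 d where "a = d0 + (\<Sum>j\<in>J. d j * b j)" "rational_gf d0"
    "\<And>j. j \<in> J \<Longrightarrow> rational_gf (d j) \<and> d j $ 0 = 0"
proof -
  obtain d0 where d0: "expansion_at_0 c0 = fps_to_fls d0" "rational_gf d0"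
    using assms(2) by (rule expansion_at_0_has_value_at)
  have "\<forall>j\<in>J. \<exists>g. expansion_at_0 (c j) = fps_to_fls g \<and> g $ 0 = 0 \<and> rational_gf g"
    using assms(3) by (meson expansion_at_0_has_value_at)
  then obtain d where d: "\<And>j. j \<in> J \<Longrightarrow> expansion_at_0 (c j) = fps_to_fls (d j)"
    "\<And>j. j \<in> J \<Longrightarrow> rational_gf (d j) \<and> d j $ 0 = 0"
    by metis
  have to_fls_sum: "fps_to_fls (sum f A) = (\<Sum>j\<in>A. fps_to_fls (f j))"
    for f :: "'b \<Rightarrow> 'a fps" and A
    by (induction A rule: infinite_finite_induct) auto
  have "fps_to_fls a = fps_to_fls (d0 + (\<Sum>j\<in>J. d j * b j))"
    using assms(1) d0 d
    by (simp add: rational_linear_combination_def to_fls_sum fls_times_fps_to_fls)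
  then have "a = d0 + (\<Sum>j\<in>J. d j * b j)" by (simp only: fps_to_fls_eq_iff)
  then show ?thesis using d0(2) d(2) by (rule that)
qed

text \<open>The condition on the constant terms says that the matrix at \<open>0\<close> is strictly triangular for
  the ranking \<open>r\<close>. It survives the elimination of any unknown.\<close>

lemma rational_gf_linear_system:
  fixes F :: "'i \<Rightarrow> 'a::field fps" and r :: "'i \<Rightarrow> nat"
  assumes "finite J"
    and "\<And>i. i \<in> J \<Longrightarrow> rational_gf (c i)"
    and "\<And>i j. i \<in> J \<Longrightarrow> j \<in> J \<Longrightarrow> rational_gf (M i j)"
    and "\<And>i j. i \<in> J \<Longrightarrow> j \<in> J \<Longrightarrow> M i j $ 0 \<noteq> 0 \<Longrightarrow> r i < r j"
    and "\<And>i. i \<in> J \<Longrightarrow> F i = c i + (\<Sum>j\<in>J. M i j * F j)"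
    and "i \<in> J"
  shows "rational_gf (F i)"
  using assms
proof (induction J arbitrary: c M i rule: finite_induct)
  case empty
  then show ?case by simp
next
  case (insert k J)
  note rc = insert.prems(1) and rM = insert.prems(2) and tri = insert.prems(3)
    and eq = insert.prems(4)
  define u where "u = inverse (1 - M k k)"
  \<comment> \<open>Otherwise \<open>tri\<close> would give \<open>r k < r k\<close>. Hence
    \<open>1 - M k k\<close> has constant term 1 and is invertible.\<close>
  have Mkk: "M k k $ 0 = 0" using tri[of k k] by auto
  then have u: "u * (1 - M k k) = 1"
    unfolding u_def by (intro inverse_mult_eq_1) simp
  have ru: "rational_gf u"
  proof -
    have "rational_gf (1 + - M k k)"
      by (intro rational_gf_add rational_gf_1 rational_gf_minus rM) auto
    then show ?thesis unfolding u_def using Mkk by (intro rational_gf_inverse) auto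
  qed
  \<comment> \<open>Row \<open>k\<close> is solved for \<open>F k\<close>: \<open>d\<close> and
    \<open>N\<close> are its constant and its other coefficients, divided by
    \<open>1 - M k k\<close>.\<close>
  define d where "d = u * c k"
  define N where "N j = u * M k j" for j
  have "F k = c k + M k k * F k + (\<Sum>j\<in>J. M k j * F j)"
    using eq[of k] insert.hyps by (simp add: add.assoc)
  then have "(1 - M k k) * F k = c k + (\<Sum>j\<in>J. M k j * F j)"
    by (simp add: algebra_simps)
  then have "(u * (1 - M k k)) * F k = u * (c k + (\<Sum>j\<in>J. M k j * F j))"
    by (simp only: mult.assoc)
  then have Fk: "F k = d + (\<Sum>j\<in>J. N j * F j)"
    unfolding u by (simp add: d_def N_def algebra_simps sum_distrib_left)
  have rd: "rational_gf d"
    unfolding d_def by (intro rational_gf_mult ru rc) simp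
  have rN: "rational_gf (N j)" if "j \<in> J" for j
    unfolding N_def using that by (intro rational_gf_mult ru rM) auto
  \<comment> \<open>Substituting the expression for \<open>F k\<close> in every other row leaves a
    system over \<open>J\<close> alone, to which the induction hypothesis applies.\<close>
  have rF: "rational_gf (F i)" if "i \<in> J" for i
  proof (rule insert.IH[where c = "\<lambda>i. c i + M i k * d" and M = "\<lambda>i j. M i j + M i k * N j"])
    fix i assume i: "i \<in> J"
    show "rational_gf (c i + M i k * d)"
      using i by (intro rational_gf_add rational_gf_mult rc rM rd) auto
    have "F i = c i + M i k * F k + (\<Sum>j\<in>J. M i j * F j)"
      using eq[of i] i insert.hyps by (simp add: add.assoc)
    also have "\<dots> = c i + M i k * d + (\<Sum>j\<in>J. (M i j + M i k * N j) * F j)"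
      unfolding Fk by (simp add: algebra_simps sum_distrib_left sum.distrib)
    finally show "F i = c i + M i k * d + (\<Sum>j\<in>J. (M i j + M i k * N j) * F j)" .
    fix j assume j: "j \<in> J"
    show "rational_gf (M i j + M i k * N j)"
      using i j by (intro rational_gf_add rational_gf_mult rM rN) auto
    assume "(M i j + M i k * N j) $ 0 \<noteq> 0"
    \<comment> \<open>A product has a nonzero constant term only if both factors do. In the new case
      \<open>r i < r k < r j\<close>.\<close>
    then have "M i j $ 0 \<noteq> 0 \<or> (M i k $ 0 \<noteq> 0 \<and> M k j $ 0 \<noteq> 0)"
      by (auto simp: N_def)
    then show "r i < r j"
      using tri[of i j] tri[of i k] tri[of k j] i j by auto
  qed (use that in auto)
  have "rational_gf (F k)"
    unfolding Fk by (intro rational_gf_add rational_gf_sum rational_gf_mult rd rN rF)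
  then show ?case using rF insert.prems(5) by auto
qed

section \<open>Levels of rooted trees\<close>

text \<open>A walk that starts at \<open>v\<close> never leaves the descendants of \<open>v\<close>,
  so restricting the edges loses no step. By truncated subtraction both sides are \<open>{v}\<close>
  at \<open>n = 0\<close>.\<close>

lemma level_subtree_at: "level (subtree_at T v) n = (tree_edges T ^^ (n - 1)) `` {v}"
proof -
  let ?E = "tree_edges T" and ?V = "(tree_edges T)\<^sup>* `` {v}"
  have "(v, w) \<in> (?E \<inter> ?V \<times> ?V) ^^ k" if "(v, w) \<in> ?E ^^ k" for w k
    using that
  proof (induction k arbitrary: w)
    case (Suc k)
    then obtain u where u: "(v, u) \<in> ?E ^^ k" "(u, w) \<in> ?E" by auto
    then have "u \<in> ?V" by (auto dest: relpow_imp_rtrancl)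
    then have "(u, w) \<in> ?E \<inter> ?V \<times> ?V" using u(2) by (auto intro: rtrancl_into_rtrancl)
    then show ?case using Suc.IH[OF u(1)] by auto
  qed simp
  moreover have "(?E \<inter> ?V \<times> ?V) ^^ k \<subseteq> ?E ^^ k" for k
    by (induction k) auto
  ultimately show ?thesis
    by (auto simp: level_def subtree_at_def Let_def dest: relpow_imp_rtrancl)
qed

text \<open>By induction on the depth, \<open>f\<close> preserves and reflects being reached from
  the root in \<open>k\<close> steps. The two inclusions, which the record type does not enforce,
  keep intermediate nodes where \<open>f\<close> is known to respect edges.\<close>

lemma card_level_rooted_tree_iso:
  assumes "rooted_tree_iso T U" "root T \<in> nodes T"
    and T: "tree_edges T \<subseteq> nodes T \<times> nodes T" and U: "tree_edges U \<subseteq> nodes U \<times> nodes U"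
  shows "card (level T n) = card (level U n)"
proof -
  obtain f where f: "bij_betw f (nodes T) (nodes U)" "f (root T) = root U"
    "\<And>x y. x \<in> nodes T \<Longrightarrow> y \<in> nodes T \<Longrightarrow> (x, y) \<in> tree_edges T \<longleftrightarrow> (f x, f y) \<in> tree_edges U"
    using assms(1) by (auto simp: rooted_tree_iso_def)
  have iff: "(root T, x) \<in> tree_edges T ^^ k \<longleftrightarrow> (root U, f x) \<in> tree_edges U ^^ k"
    if "x \<in> nodes T" for x k
    using that
  proof (induction k arbitrary: x)
    case 0
    have "f (root T) = f x \<longleftrightarrow> root T = x"
      using f(1) assms(2) 0 by (meson bij_betw_imp_inj_on inj_on_eq_iff)
    then show ?case using f(2) by simp
  next
    case (Suc k)
    show ?case
    proof
      assume "(root T, x) \<in> tree_edges T ^^ Suc k"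
      then obtain y where y: "(root T, y) \<in> tree_edges T ^^ k" "(y, x) \<in> tree_edges T" by auto
      then have "y \<in> nodes T" using T by auto
      then show "(root U, f x) \<in> tree_edges U ^^ Suc k"
        using y Suc.IH f(3) Suc.prems by auto
    next
      assume "(root U, f x) \<in> tree_edges U ^^ Suc k"
      then obtain z where z: "(root U, z) \<in> tree_edges U ^^ k" "(z, f x) \<in> tree_edges U" by auto
      then have "z \<in> nodes U" using U by auto
      then obtain y where "y \<in> nodes T" "z = f y"
        using f(1) by (auto simp: bij_betw_def)
      then show "(root T, x) \<in> tree_edges T ^^ Suc k"
        using z Suc.IH f(3) Suc.prems by auto
    qed
  qed
  have "nodes U = f ` nodes T" using f(1) by (simp add: bij_betw_def)
  then have "level U n = f ` level T n" using iff by (auto simp: level_def)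
  moreover have "inj_on f (level T n)"
    using f(1) by (auto simp: bij_betw_def level_def intro: inj_on_subset)
  ultimately show ?thesis by (simp add: card_image)
qed

text \<open>Single-valuedness of the converse says that each vertex has at most one parent. So
  different children have disjoint sets of descendants at depth \<open>k\<close>, and the
  cardinalities add up.\<close>

lemma card_relpow_Suc_Image:
  assumes "finite (E `` {v})" "\<And>\<sigma>. finite ((E ^^ k) `` {\<sigma>})" "single_valued (E\<inverse>)"
  shows "card ((E ^^ Suc k) `` {v}) = (\<Sum>\<sigma>\<in>E `` {v}. card ((E ^^ k) `` {\<sigma>}))"
proof -
  have uniq: "\<sigma> = \<sigma>'" if "(\<sigma>, \<tau>) \<in> E ^^ k" "(\<sigma>', \<tau>) \<in> E ^^ k" for \<sigma> \<sigma>' \<tau>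
    using that
  proof (induction k arbitrary: \<tau>)
    case (Suc k)
    then show ?case using assms(3) by (auto simp: single_valued_def)
  qed simp
  \<comment> \<open>A relation power splits off its last step; commuting brings the first step, from
    \<open>v\<close> to a child, to the front.\<close>
  have "(E ^^ Suc k) `` {v} = (\<Union>\<sigma>\<in>E `` {v}. (E ^^ k) `` {\<sigma>})"
    by (simp add: relpow_commute[symmetric] relcomp_Image) auto
  then show ?thesis
    using assms(1,2) uniq by (simp only:) (subst card_UN_disjoint, auto)
qed

section \<open>The pattern-avoidance tree\<close>

lemma perms_of_length_iff:
  "\<sigma> \<in> perms_of_length n \<longleftrightarrow> set \<sigma> = {1..n} \<and> distinct \<sigma>"
  by (simp add: perms_of_length_def permutations_of_set_def)

lemma length_perms_of_length: "\<sigma> \<in> perms_of_length n \<Longrightarrow> length \<sigma> = n"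
  using distinct_card[of \<sigma>] by (simp add: perms_of_length_iff)

lemma avoiders_iff:
  "\<sigma> \<in> avoiders B \<longleftrightarrow> length \<sigma> \<ge> 1 \<and> \<sigma> \<in> avoiders_of_length B (length \<sigma>)"
  by (auto simp: avoiders_def avoiders_of_length_def length_perms_of_length)

lemma avoiders_of_length_eq: "n \<ge> 1 \<Longrightarrow> avoiders_of_length B n = {\<sigma> \<in> avoiders B. length \<sigma> = n}"
  by (auto simp: avoiders_iff) (auto simp: avoiders_of_length_def length_perms_of_length)

lemma finite_avoiders_of_length: "finite (avoiders_of_length B n)"
  by (simp add: avoiders_of_length_def perms_of_length_def)

section \<open>Deleting the largest letter\<close>

lemma contains_append_Cons:
  assumes "contains (ys @ zs) \<tau>"
  shows "contains (ys @ x # zs) \<tau>"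
proof -
  obtain i where i: "strict_mono_on {..<length \<tau>} i" "\<And>a. a < length \<tau> \<Longrightarrow> i a < length (ys @ zs)"
    "\<And>a b. a < length \<tau> \<Longrightarrow> b < length \<tau> \<Longrightarrow> (ys @ zs) ! i a < (ys @ zs) ! i b \<longleftrightarrow> \<tau> ! a < \<tau> ! b"
    using assms by (auto simp: contains_def)
  \<comment> \<open>\<open>s\<close> skips the position \<open>length ys\<close> of the new letter,
    so it sends each position of the shorter word to that of the same letter in the longer
    one.\<close>
  define s where "s j = (if j < length ys then j else Suc j)" for j
  have s: "(ys @ x # zs) ! s j = (ys @ zs) ! j" for j
    by (auto simp: s_def nth_append Suc_diff_le)
  have mono: "s j < s j'" if "j < j'" for j j'
    using that by (auto simp: s_def)
  have "strict_mono_on {..<length \<tau>} (s \<circ> i)"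
    using i(1) mono by (simp add: strict_mono_on_def)
  moreover have "s (i a) < length (ys @ x # zs)" if "a < length \<tau>" for a
    using i(2)[OF that] by (auto simp: s_def)
  ultimately show ?thesis
    unfolding contains_def using i(3) by (intro exI[of _ "s \<circ> i"]) (simp add: s)
qed

text \<open>An occurrence of a pattern in the shorter word would reappear in \<sigma> once the
  letter is put back. The bound on the length keeps the shorter word nonempty.\<close>

lemma delete_max_avoiders:
  assumes "\<sigma> \<in> avoiders B" "length \<sigma> \<ge> 2"
  shows "delete_max \<sigma> \<in> avoiders B" "length \<sigma> = Suc (length (delete_max \<sigma>))"
proof -
  define n where "n = length \<sigma>"
  have \<sigma>: "set \<sigma> = {1..n}" "distinct \<sigma>" and av: "\<And>\<tau>. \<tau> \<in> B \<Longrightarrow> \<not> contains \<sigma> \<tau>"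
    using assms by (auto simp: avoiders_iff avoiders_of_length_def perms_of_length_iff n_def)
  have "n \<in> set \<sigma>" using \<sigma> assms(2) by (simp add: n_def)
  then obtain ys zs where split: "\<sigma> = ys @ n # zs" by (auto dest: split_list)
  then have del: "delete_max \<sigma> = ys @ zs"
    using \<sigma>(2) unfolding delete_max_def n_def[symmetric] by simp
  then show len: "length \<sigma> = Suc (length (delete_max \<sigma>))" using split by simp
  have "set (delete_max \<sigma>) = {1..n} - {n}"
    using \<sigma> by (simp add: delete_max_def n_def)
  also have "\<dots> = {1..length (delete_max \<sigma>)}" using len by (auto simp: n_def)
  finally have "delete_max \<sigma> \<in> perms_of_length (length (delete_max \<sigma>))"
    using \<sigma>(2) by (simp add: perms_of_length_iff delete_max_def distinct_removeAll)
  moreover have "\<not> contains (delete_max \<sigma>) \<tau>" if "\<tau> \<in> B" for \<tau>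
    using av[OF that] contains_append_Cons split del by metis
  ultimately show "delete_max \<sigma> \<in> avoiders B"
    using assms(2) len by (auto simp: avoiders_iff avoiders_of_length_def)
qed

text \<open>A pattern occurring in \<open>[1]\<close> has at most one letter. Elements of
  \<open>all_perms\<close> have at least one, which excludes the empty word, so only
  \<open>[1]\<close> itself remains.\<close>

lemma singleton_avoiders:
  assumes "B \<subseteq> all_perms" "[1] \<notin> B"
  shows "[1] \<in> avoiders B"
proof -
  have "\<not> contains [1] \<tau>" if "\<tau> \<in> B" for \<tau>
  proof
    assume "contains [1] \<tau>"
    then obtain i :: "nat \<Rightarrow> nat" where i: "strict_mono_on {..<length \<tau>} i" "\<And>a. a < length \<tau> \<Longrightarrow> i a < 1"
      by (auto simp: contains_def)
    have "\<not> length \<tau> \<ge> 2"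
    proof
      assume "length \<tau> \<ge> 2"
      then have \<tau>: "0 \<in> {..<length \<tau>}" "1 \<in> {..<length \<tau>}" by auto
      have "i 0 < i 1" by (rule strict_mono_onD[OF i(1) \<tau>]) simp
      moreover have "i 1 < 1" using \<tau> by (intro i(2)) simp
      ultimately show False by simp
    qed
    moreover have "\<tau> \<in> all_perms" using that assms(1) by blast
    then obtain n where n: "n \<ge> 1" "\<tau> \<in> perms_of_length n"
      by (auto simp: all_perms_def)
    ultimately have "n = 1" using length_perms_of_length by fastforce
    then have "length \<tau> = 1" "set \<tau> = {1}"
      using n length_perms_of_length by (auto simp: perms_of_length_iff)
    then have "\<tau> = [1]" by (cases \<tau>) simp_all
    then show False using that assms(2) by simp
  qed
  then show ?thesis
    by (simp add: avoiders_iff avoiders_of_length_def perms_of_length_iff)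
qed

section \<open>Edges and paths of the tree\<close>

lemma avoidance_edge:
  assumes "(v, \<sigma>) \<in> tree_edges (avoidance_tree B)"
  shows "v \<in> avoiders B" "\<sigma> \<in> avoiders B" "length \<sigma> = Suc (length v)"
  using assms delete_max_avoiders by (auto simp: avoidance_tree_def)

text \<open>For \<open>k = 0\<close> the relation links every word to itself, avoider or not, so
  membership can only be transferred. A nonempty path forces its start to be an avoider.\<close>

lemma avoidance_relpow:
  assumes "(v, \<sigma>) \<in> tree_edges (avoidance_tree B) ^^ k"
  shows "length \<sigma> = length v + k \<and> (v \<in> avoiders B \<longleftrightarrow> \<sigma> \<in> avoiders B) \<and> (k > 0 \<longrightarrow> v \<in> avoiders B)"
  using assms
proof (induction k arbitrary: \<sigma>)
  case (Suc k)
  then obtain u where "(v, u) \<in> tree_edges (avoidance_tree B) ^^ k"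
    "(u, \<sigma>) \<in> tree_edges (avoidance_tree B)" by auto
  then show ?case using Suc.IH[of u] avoidance_edge[of u \<sigma>] by auto
qed simp

lemma finite_avoidance_relpow: "finite ((tree_edges (avoidance_tree B) ^^ k) `` {v})"
proof (cases "k = 0")
  case False
  have "(tree_edges (avoidance_tree B) ^^ k) `` {v} \<subseteq> avoiders_of_length B (length v + k)"
    using False by (auto dest!: avoidance_relpow simp: avoiders_iff)
  then show ?thesis using finite_avoiders_of_length finite_subset by blast
qed auto

lemma single_valued_parent: "single_valued ((tree_edges (avoidance_tree B))\<inverse>)"
  by (auto simp: single_valued_def avoidance_tree_def)

text \<open>Deleting the largest letter \<open>k\<close> times leads back to \<open>[1]\<close>. So
  every avoider is reached from the root, at a depth one less than its length.\<close>

lemma avoiders_relpow: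
  assumes "\<sigma> \<in> avoiders B" "length \<sigma> = Suc k"
  shows "([1], \<sigma>) \<in> tree_edges (avoidance_tree B) ^^ k"
  using assms
proof (induction k arbitrary: \<sigma>)
  case 0
  then have "set \<sigma> = {1}" "length \<sigma> = 1"
    by (auto simp: avoiders_iff avoiders_of_length_def perms_of_length_iff)
  then have "\<sigma> = [1]" by (cases \<sigma>) simp_all
  then show ?case by simp
next
  case (Suc k)
  then have "([1], delete_max \<sigma>) \<in> tree_edges (avoidance_tree B) ^^ k"
    using delete_max_avoiders[of \<sigma> B] by (intro Suc.IH) auto
  moreover have "(delete_max \<sigma>, \<sigma>) \<in> tree_edges (avoidance_tree B)"
    using Suc.prems by (auto simp: avoidance_tree_def)
  ultimately show ?case by auto
qed

lemma avoiders_gf_eq_subtree_gf: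
  assumes "[1] \<in> avoiders B"
  shows "avoiders_gf B = subtree_gf B [1]"
proof -
  have "avoiders_of_length B n = level (avoidance_subtree B [1]) n" if "n \<noteq> 0" for n
  proof -
    have "avoiders_of_length B n = (tree_edges (avoidance_tree B) ^^ (n - 1)) `` {[1]}"
      using that assms avoidance_relpow[of "[1]" _ "n - 1" B] avoiders_relpow[of _ B "n - 1"]
      by (auto simp: avoiders_of_length_eq)
    then show ?thesis by (simp add: avoidance_subtree_def level_subtree_at)
  qed
  then show ?thesis
    by (auto simp: avoiders_gf_def subtree_gf_def fps_eq_iff)
qed

section \<open>Level counts and equivalence\<close>

lemma card_level_equivalent:
  assumes "equivalent B \<pi> \<pi>'"
  shows "card (level (avoidance_subtree B \<pi>) n) = card (level (avoidance_subtree B \<pi>') n)"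
  using assms unfolding equivalent_def
  by (rule card_level_rooted_tree_iso)
    (auto simp: avoidance_subtree_def subtree_at_def Let_def)

text \<open>The series of \<open>subtree_gf\<close> without the shift by the length of \<pi>. It
  depends only on the isomorphism type of the tree below \<pi>.\<close>

definition level_gf :: "perm_word set \<Rightarrow> perm_word \<Rightarrow> 'a::field_char_0 fps" where
  "level_gf B \<pi> =
     Abs_fps (\<lambda>n. if n = 0 then 0 else of_nat (card (level (avoidance_subtree B \<pi>) n)))"

lemma subtree_gf_eq: "subtree_gf B \<pi> = fps_X ^ (length \<pi> - 1) * level_gf B \<pi>"
  by (simp add: subtree_gf_def level_gf_def)

lemma level_gf_equivalent: "equivalent B \<pi> \<pi>' \<Longrightarrow> level_gf B \<pi> = level_gf B \<pi>'"
  by (simp add: level_gf_def card_level_equivalent cong: if_cong)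

text \<open>The root contributes the single term x, and level \<open>n + 1\<close> below
  \<open>v\<close> is the disjoint union of the levels \<open>n\<close> below its children, for
  \<open>n \<ge> 1\<close>.\<close>

lemma level_gf_children:
  "level_gf B v = fps_X * (1 + (\<Sum>\<sigma>\<in>tree_edges (avoidance_tree B) `` {v}. level_gf B \<sigma>))"
proof (rule fps_ext)
  fix n
  let ?E = "tree_edges (avoidance_tree B)"
  have lev: "level (avoidance_subtree B \<sigma>) n = (?E ^^ (n - 1)) `` {\<sigma>}" for \<sigma> n
    by (simp add: avoidance_subtree_def level_subtree_at)
  have fin: "finite (?E `` {v})" using finite_avoidance_relpow[of 1 B v] by simp
  consider "n = 0" | "n = 1" | k where "n = Suc (Suc k)"
    by (metis One_nat_def not0_implies_Suc)
  then show "level_gf B v $ n = (fps_X * (1 + (\<Sum>\<sigma>\<in>?E `` {v}. level_gf B \<sigma>))) $ n"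
  proof cases
    case 3
    \<comment> \<open>Level \<open>Suc (Suc k)\<close> lies at depth \<open>Suc k\<close>. The
      factor \<open>fps_X\<close> selects the children's coefficient at \<open>Suc k\<close>, which
      counts depth \<open>k\<close>.\<close>
    have "card ((?E ^^ Suc k) `` {v}) = (\<Sum>\<sigma>\<in>?E `` {v}. card ((?E ^^ k) `` {\<sigma>}))"
      by (rule card_relpow_Suc_Image[OF fin finite_avoidance_relpow single_valued_parent])
    then show ?thesis
      using 3 by (simp add: level_gf_def fps_sum_nth lev del: relpow.simps)
  qed (auto simp: level_gf_def fps_sum_nth lev)
qed

section \<open>The linear system\<close>

text \<open>The head of the arc \<open>(v, \<sigma>)\<close> in \<open>class_digraph B R\<close>,
  which depends on \<sigma> only.\<close>

definition representative :: "perm_word set \<Rightarrow> perm_word set \<Rightarrow> perm_word \<Rightarrow> perm_word" where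
  "representative B R \<sigma> = (THE w. w \<in> R \<and> equivalent B \<sigma> w)"

lemma representative:
  assumes "minimal_representatives B R" "\<sigma> \<in> avoiders B"
  shows "representative B R \<sigma> \<in> R" "equivalent B \<sigma> (representative B R \<sigma>)"
    "length (representative B R \<sigma>) \<le> length \<sigma>"
proof -
  have "\<exists>!w. w \<in> R \<and> equivalent B \<sigma> w"
    using assms by (auto simp: minimal_representatives_def)
  from theI'[OF this] show 1: "representative B R \<sigma> \<in> R" "equivalent B \<sigma> (representative B R \<sigma>)"
    by (auto simp: representative_def)
  then show "length (representative B R \<sigma>) \<le> length \<sigma>"
    using assms by (auto simp: minimal_representatives_def)
qed

lemma finite_representatives:
  assumes "minimal_representatives B R"
  shows "finite {w. w \<in> R \<and> length w \<le> m}"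
proof (rule finite_subset)
  show "{w. w \<in> R \<and> length w \<le> m} \<subseteq> (\<Union>n\<in>{..m}. avoiders_of_length B n)"
  proof
    fix w assume "w \<in> {w. w \<in> R \<and> length w \<le> m}"
    moreover from this have "w \<in> avoiders B"
      using assms by (auto simp: minimal_representatives_def)
    ultimately show "w \<in> (\<Union>n\<in>{..m}. avoiders_of_length B n)"
      by (auto simp: avoiders_iff)
  qed
qed (simp add: finite_avoiders_of_length)

text \<open>Replacing a child by its representative keeps \<open>level_gf\<close> and changes only
  the shift; the power of \<open>fps_X\<close> under the sum makes up for the difference in
  length.\<close>

lemma subtree_gf_children:
  assumes "minimal_representatives B R" "v \<in> avoiders B"
  shows "subtree_gf B v = fps_X ^ length v +
    (\<Sum>\<sigma>\<in>tree_edges (avoidance_tree B) `` {v}.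
       fps_X ^ (Suc (length v) - length (representative B R \<sigma>)) * subtree_gf B (representative B R \<sigma>))"
proof -
  let ?C = "tree_edges (avoidance_tree B) `` {v}" and ?w = "representative B R"
  have "length v \<ge> 1" using assms(2) by (simp add: avoiders_iff)
  then have X: "fps_X ^ (length v - 1) * fps_X = (fps_X ^ length v :: 'a fps)"
    by (metis One_nat_def Suc_diff_le diff_Suc_Suc diff_zero power_Suc2)
  have child: "fps_X ^ length v * level_gf B \<sigma> =
      fps_X ^ (Suc (length v) - length (?w \<sigma>)) * (subtree_gf B (?w \<sigma>) :: 'a fps)" if "\<sigma> \<in> ?C" for \<sigma>
  proof -
    have \<sigma>: "\<sigma> \<in> avoiders B" "length \<sigma> = Suc (length v)"
      using that avoidance_edge[of v \<sigma> B] by auto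
    note w = representative[OF assms(1) \<sigma>(1)]
    have "?w \<sigma> \<in> avoiders B" using w(1) assms(1) by (auto simp: minimal_representatives_def)
    then have "length (?w \<sigma>) \<ge> 1" by (simp add: avoiders_iff)
    \<comment> \<open>Both truncated subtractions are exact: the representative has length between 1
      and \<open>Suc (length v)\<close>.\<close>
    then have "length v = (Suc (length v) - length (?w \<sigma>)) + (length (?w \<sigma>) - 1)"
      using w(3) \<sigma>(2) by simp
    then have "fps_X ^ length v =
        (fps_X ^ (Suc (length v) - length (?w \<sigma>)) * fps_X ^ (length (?w \<sigma>) - 1) :: 'a fps)"
      by (metis power_add)
    then show ?thesis
      by (simp only: subtree_gf_eq mult.assoc level_gf_equivalent[OF w(2)])
  qed
  have "subtree_gf B v = (fps_X ^ (length v - 1) * fps_X) * (1 + (\<Sum>\<sigma>\<in>?C. level_gf B \<sigma>) :: 'a fps)"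
    by (simp add: subtree_gf_eq level_gf_children[of B v] mult.assoc)
  also have "\<dots> = fps_X ^ length v + (\<Sum>\<sigma>\<in>?C. fps_X ^ length v * level_gf B \<sigma>)"
    by (simp only: X distrib_left sum_distrib_left mult_1_right)
  finally show ?thesis by (simp add: child)
qed

text \<open>Children with the same representative are collected into one coefficient. A
  representative is no longer than the child, so \<open>length v < m\<close> keeps it among the
  unknowns.\<close>

lemma subtree_gf_linear_equation:
  assumes "minimal_representatives B R" "v \<in> R" "length v < m"
  obtains d0 and d :: "perm_word \<Rightarrow> 'a::field_char_0 fps"
  where "subtree_gf B v = d0 + (\<Sum>w | w \<in> R \<and> length w \<le> m. d w * subtree_gf B w)"
    "rational_gf d0" "\<And>w. rational_gf (d w)" "\<And>w. d w $ 0 \<noteq> 0 \<Longrightarrow> length v < length w"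
proof -
  let ?C = "tree_edges (avoidance_tree B) `` {v}" and ?w = "representative B R"
  let ?J = "{w. w \<in> R \<and> length w \<le> m}"
  \<comment> \<open>The number of arcs from \<open>v\<close> to \<open>w\<close> times a power of
    x.\<close>
  define d :: "perm_word \<Rightarrow> 'a fps" where
    "d w = (\<Sum>\<sigma> | \<sigma> \<in> ?C \<and> ?w \<sigma> = w. fps_X ^ (Suc (length v) - length w))" for w
  have v: "v \<in> avoiders B" using assms by (auto simp: minimal_representatives_def)
  have fin: "finite ?C" using finite_avoidance_relpow[of 1 B v] by simp
  note finJ = finite_representatives[OF assms(1), of m]
  have img: "?w ` ?C \<subseteq> ?J"
    using avoidance_edge[of v _ B] representative[OF assms(1)] assms(3) by fastforce
  have "subtree_gf B v = fps_X ^ length v +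
      (\<Sum>w\<in>?J. \<Sum>\<sigma> | \<sigma> \<in> ?C \<and> ?w \<sigma> = w.
         fps_X ^ (Suc (length v) - length (?w \<sigma>)) * (subtree_gf B (?w \<sigma>) :: 'a fps))"
    unfolding subtree_gf_children[OF assms(1) v] by (simp only: sum.group[OF fin finJ img])
  also have "\<dots> = fps_X ^ length v + (\<Sum>w\<in>?J. d w * subtree_gf B w)"
    unfolding d_def sum_distrib_right by (intro arg_cong2[of _ _ _ _ "(+)"] refl sum.cong) auto
  finally have "subtree_gf B v = fps_X ^ length v + (\<Sum>w\<in>?J. d w * (subtree_gf B w :: 'a fps))" .
  moreover have "rational_gf (d w)" for w
    unfolding d_def by (intro rational_gf_sum rational_gf_X_power)
  moreover have "length v < length w" if "d w $ 0 \<noteq> 0" for w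
  proof (rule ccontr)
    assume "\<not> length v < length w"
    \<comment> \<open>The exponent \<open>Suc (length v) - length w\<close> is now positive, so
      every summand vanishes at 0.\<close>
    then have "d w $ 0 = 0" by (simp add: d_def fps_sum_nth)
    then show False using that by simp
  qed
  ultimately show ?thesis using that[of "fps_X ^ length v" d] rational_gf_X_power by blast
qed

theorem theorem5:
  fixes B R :: "perm_word set" and m :: nat
  assumes "B \<subseteq> all_perms" and "[1] \<notin> B" and "m \<ge> 1"
    and "minimal_representatives B R"
    and "\<forall>\<pi>\<in>verts (class_digraph B R). length \<pi> = m \<longrightarrow>
           (\<exists>c0 c. rational_linear_combination (subtree_gf B \<pi> :: 'a::field_char_0 fps) (subtree_gf B)
                     {\<pi>'\<in>verts (class_digraph B R). length \<pi>' \<le> m} c0 c \<and>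
                   has_value_at c0 0 0 \<and>
                   (\<forall>\<pi>'\<in>verts (class_digraph B R). length \<pi>' \<le> m \<longrightarrow> has_value_at (c \<pi>') 0 0))"
  shows "rational_gf (avoiders_gf B :: 'a fps)"
proof -
  let ?J = "{w. w \<in> R \<and> length w \<le> m}"
  let ?F = "subtree_gf B :: perm_word \<Rightarrow> 'a fps"
  have verts: "verts (class_digraph B R) = R" by (simp add: class_digraph_def)
  have one: "[1] \<in> avoiders B" by (rule singleton_avoiders[OF assms(1,2)])
  note finJ = finite_representatives[OF assms(4), of m]
  have "\<forall>v\<in>?J. \<exists>d0 d. ?F v = d0 + (\<Sum>w\<in>?J. d w * ?F w) \<and> rational_gf d0 \<and>
      (\<forall>w\<in>?J. rational_gf (d w) \<and> (d w $ 0 \<noteq> 0 \<longrightarrow> length v < length w))"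
    (is "\<forall>v\<in>?J. \<exists>d0 d. ?P v d0 d")
  proof
    fix v assume v: "v \<in> ?J"
    show "\<exists>d0 d. ?P v d0 d"
    \<comment> \<open>Below length \<open>m\<close> the row comes from the children. At length
      \<open>m\<close> it comes from the hypothesis, whose vanishing constant terms make the
      condition on lengths vacuous.\<close>
    proof (cases "length v < m")
      case True
      have "v \<in> R" using v by simp
      then obtain d0 and d :: "perm_word \<Rightarrow> 'a fps"
        where "?F v = d0 + (\<Sum>w\<in>?J. d w * ?F w)" "rational_gf d0"
          "\<And>w. rational_gf (d w)" "\<And>w. d w $ 0 \<noteq> 0 \<Longrightarrow> length v < length w"
        by (rule subtree_gf_linear_equation[OF assms(4) _ True]) (rule that)
      then show ?thesis by blast
    next
      case False
      then have "length v = m" "v \<in> R" using v by auto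
      then obtain c0 c where c: "rational_linear_combination (?F v) ?F ?J c0 c" "has_value_at c0 0 0"
        "\<forall>w\<in>R. length w \<le> m \<longrightarrow> has_value_at (c w) 0 0"
        using assms(5) unfolding verts by blast
      then have "has_value_at (c w) 0 0" if "w \<in> ?J" for w using that by simp
      then obtain d0 d where "?F v = d0 + (\<Sum>w\<in>?J. d w * ?F w)" "rational_gf d0"
        "\<And>w. w \<in> ?J \<Longrightarrow> rational_gf (d w) \<and> d w $ 0 = 0"
        by (rule rational_linear_combination_fps[OF c(1,2)]) (assumption, rule that)
      then show ?thesis by blast
    qed
  qed
  from bchoice[OF this] obtain d0 where "\<forall>v\<in>?J. \<exists>d. ?P v (d0 v) d" ..
  from bchoice[OF this] obtain d where d: "\<forall>v\<in>?J. ?P v (d0 v) (d v)" ..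
  let ?w = "representative B R [1]"
  note w = representative[OF assms(4) one]
  \<comment> \<open>Minimality forces the representative of the root to have length 1. So it is
    among the unknowns, as \<open>m \<ge> 1\<close>, and has the same shift as
    \<open>[1]\<close>.\<close>
  have "?w \<in> avoiders B" using w(1) assms(4) by (auto simp: minimal_representatives_def)
  then have len: "length ?w = length [1 :: nat]" using w(3) by (simp add: avoiders_iff le_antisym)
  then have "rational_gf (?F ?w)"
    using d w(1) assms(3)
    by (intro rational_gf_linear_system[OF finJ, of d0 d length ?F]) auto
  moreover have "?F [1] = ?F ?w"
    by (simp only: subtree_gf_eq len level_gf_equivalent[OF w(2)])
  ultimately show ?thesis by (simp only: avoiders_gf_eq_subtree_gf[OF one])
qed

end
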